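(* Let $H$ be an anti-flexible bialgebra, and let $A$ be an anti-flexible algebra and an anti-flexible coalgebra in ${}^{H}_{H}\mathcal{M}{}^{H}_{H}$, with actions $\triangleright: H\otimes A\to A$, $\triangleleft: A\otimes H\to A$ and coactions $\phi: A\to H\otimes A$, $\psi: A\to A\otimes H$. On $E:=A\oplus H$ define $$(a,x)(b,y):=(ab+x\triangleright b+a\triangleleft y,\ xy),\qquad \Delta_E(a,x):=\Delta_A(a)+\phi(a)+\psi(a)+\Delta_H(x)$$ for $a,b\in A$, $x,y\in H$. Then $E$ (the biproduct of $A$ and $H$) with this multiplication and comultiplication is an anti-flexible bialgebra if and only if $A$ is a braided anti-flexible bialgebra in ${}^{H}_{H}\mathcal{M}{}^{H}_{H}$.
   Context: All vector spaces are over a fixed field of characteristic zero; $\tau(u\otimes v)=v\otimes u$ and $\tau_{13}(u\otimes v\otimes w)=w\otimes v\otimes u$. Sigma notation (sums suppressed): $\Delta(a)=a_1\otimes a_2$, $\phi(v)=v_{(-1)}\otimes v_{(0)}$, $\psi(v)=v_{(0)}\otimes v_{(1)}$. Anti-flexible algebra: a vector space with bilinear product satisfying $(ab)c-a(bc)=(cb)a-c(ba)$. Anti-flexible coalgebra: a vector space with linear $\Delta:A\to A\otimes A$ satisfying $T=\tau_{13}T$, where $T=(\Delta\otimes\mathrm{id})\Delta-(\mathrm{id}\otimes\Delta)\Delta$. Anti-flexible bialgebra: both, with, for all $a,b$, $\Delta(ab)+\tau\Delta(ba)=a_1b\otimes a_2+ba_2\otimes a_1+b_1\otimes ab_2+b_2\otimes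 b_1a$ and $(\mathrm{id}-\tau)(a_1\otimes a_2b+ab_1\otimes b_2-ba_1\otimes a_2-b_1\otimes b_2a)=0$. Let $H$ be an anti-flexible bialgebra. $H$-bimodule: a space $V$ with $\triangleright:H\otimes V\to V$, $\triangleleft:V\otimes H\to V$ such that $(xy)\triangleright v-x\triangleright(y\triangleright v)=(v\triangleleft y)\triangleleft x-v\triangleleft(yx)$ and $(x\triangleright v)\triangleleft y-x\triangleright(v\triangleleft y)=(y\triangleright v)\triangleleft x-y\triangleright(v\triangleleft x)$. $H$-bicomodule: a space $V$ with $\phi:V\to H\otimes V$, $\psi:V\to V\otimes H$ such that $(\Delta_H\otimes\mathrm{id})\phi-(\mathrm{id}\otimes\phi)\phi=\tau_{13}((\psi\otimes\mathrm{id})\psi-(\mathrm{id}\otimes\Delta_H)\psi)$ and $(\phi\otimes\mathrm{id})\psi-(\mathrm{id}\otimes\psi)\phi=\tau_{13}((\phi\otimes\mathrm{id})\psi-(\mathrm{id}\otimes\psi)\phi)$. Anti-flexible Hopf bimodule over $H$ (category ${}^{H}_{H}\mathcal{M}{}^{H}_{H}$): a space $V$ that is an $H$-bimodule and an $H$-bicomodule with, for $x\in H$, $v\in V$: - $\phi(x\triangleright v)+\tau\psi(v\triangleleft x)=v_{(-1)}\otimes(x\triangleright v_{(0)})+v_{(1)}\otimes(v_{(0)}\triangleleft x)$; - $\psi(x\triangleright v)+\tau\phi(v\triangleleft x)=(x_1\triangleright v)\otimes x_2+v_{(0)}\otimes xv_{(1)}+v_{(0)}\otimes v_{(-1)}x+(v\triangleleft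 x_2)\otimes x_1$; - $(x\triangleright v_{(0)})\otimes v_{(1)}-(v\triangleleft x_1)\otimes x_2-v_{(0)}\otimes v_{(1)}x=\tau\big(xv_{(-1)}\otimes v_{(0)}+x_1\otimes(x_2\triangleright v)-v_{(-1)}\otimes(v_{(0)}\triangleleft x)\big)$. $A$ is an anti-flexible algebra and an anti-flexible coalgebra in ${}^{H}_{H}\mathcal{M}{}^{H}_{H}$ if $A$ is an anti-flexible algebra, an anti-flexible coalgebra, an object of ${}^{H}_{H}\mathcal{M}{}^{H}_{H}$, and for all $a,b\in A$, $x\in H$: - ($H$-bimodule algebra) $(x\triangleright a)b-x\triangleright(ab)=(ba)\triangleleft x-b(a\triangleleft x)$ and $a(x\triangleright b)-(a\triangleleft x)b=b(x\triangleright a)-(b\triangleleft x)a$; - ($H$-bicomodule coalgebra) $\phi(a_1)\otimes a_2-a_{(-1)}\otimes\Delta_A(a_{(0)})=\tau_{13}(\Delta_A(a_{(0)})\otimes a_{(1)}-a_1\otimes\psi(a_2))$ and $\psi(a_1)\otimes a_2-a_1\otimes\phi(a_2)=\tau_{13}(\psi(a_1)\otimes a_2-a_1\otimes\phi(a_2))$; - ($H$-bicomodule algebra) $\phi(ab)+\tau\psi(ba)=b_{(-1)}\otimes ab_{(0)}+b_{(1)}\otimes b_{(0)}a$ and $a_{(-1)}\otimes a_{(0)}b-b_{(-1)}\otimes b_{(0)}a=\tau(ab_{(0)}\otimes b_{(1)}-ba_{(0)}\otimes a_{(1)})$; - ($H$-bimodule coalgebra) $\Delta_A(x\triangleright b)+\tau\Delta_A(b\triangleleft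 x)=b_2\otimes(b_1\triangleleft x)+b_1\otimes(x\triangleright b_2)$ and $(\mathrm{id}-\tau)((x\triangleright b_1)\otimes b_2-b_1\otimes(b_2\triangleleft x))=0$. Such an $A$ is a braided anti-flexible bialgebra in ${}^{H}_{H}\mathcal{M}{}^{H}_{H}$ if moreover, for all $a,b\in A$: - $\Delta_A(ab)+\tau\Delta_A(ba)=a_1b\otimes a_2+ba_2\otimes a_1+b_1\otimes ab_2+b_2\otimes b_1a+(a_{(-1)}\triangleright b)\otimes a_{(0)}+(b\triangleleft a_{(1)})\otimes a_{(0)}+b_{(0)}\otimes(a\triangleleft b_{(1)})+b_{(0)}\otimes(b_{(-1)}\triangleright a)$; - $(\mathrm{id}-\tau)\big(a_1\otimes a_2b-ba_1\otimes a_2-b_1\otimes b_2a+ab_1\otimes b_2\big)+(\mathrm{id}-\tau)\big(a_{(0)}\otimes(a_{(1)}\triangleright b)-(b\triangleleft a_{(-1)})\otimes a_{(0)}-b_{(0)}\otimes(b_{(1)}\triangleright a)+(a\triangleleft b_{(-1)})\otimes b_{(0)}\big)=0$. *)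

theory Defs
  imports "HOL-Analysis.Product_Vector" "HOL-Library.Function_Algebras"
begin

section \<open>Tensor products of vector spaces\<close>

text \<open>
  Vector spaces are types with an explicit scalar multiplication, as in \<^locale>\<open>vector_space\<close>.
  Because a type cannot depend on the scalar multiplication, the tensor product is realised as a
  subspace of a function space: \<open>a \<otimes> b\<close> is evaluation at \<open>(a, b)\<close>, acting on bilinear forms, and
  \<open>A \<otimes> B\<close> is the span of these functionals. Functionals are set to 0 on functions that are not
  bilinear forms. The universal property is proved below (\<open>tens_universal\<close>, \<open>tens3_universal\<close>).
\<close>

definition bilinear_map ::
  "('k::field \<Rightarrow> 'a::ab_group_add \<Rightarrow> 'a) \<Rightarrow> ('k \<Rightarrow> 'b::ab_group_add \<Rightarrow> 'b) \<Rightarrow>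
   ('k \<Rightarrow> 'w::ab_group_add \<Rightarrow> 'w) \<Rightarrow> ('a \<Rightarrow> 'b \<Rightarrow> 'w) \<Rightarrow> bool" where
  "bilinear_map sA sB sW f \<longleftrightarrow>
     (\<forall>b. Vector_Spaces.linear sA sW (\<lambda>a. f a b)) \<and>
     (\<forall>a. Vector_Spaces.linear sB sW (\<lambda>b. f a b))"

definition trilinear_map ::
  "('k::field \<Rightarrow> 'a::ab_group_add \<Rightarrow> 'a) \<Rightarrow> ('k \<Rightarrow> 'b::ab_group_add \<Rightarrow> 'b) \<Rightarrow>
   ('k \<Rightarrow> 'c::ab_group_add \<Rightarrow> 'c) \<Rightarrow> ('k \<Rightarrow> 'w::ab_group_add \<Rightarrow> 'w) \<Rightarrow>
   ('a \<Rightarrow> 'b \<Rightarrow> 'c \<Rightarrow> 'w) \<Rightarrow> bool" where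
  "trilinear_map sA sB sC sW f \<longleftrightarrow>
     (\<forall>b c. Vector_Spaces.linear sA sW (\<lambda>a. f a b c)) \<and>
     (\<forall>a c. Vector_Spaces.linear sB sW (\<lambda>b. f a b c)) \<and>
     (\<forall>a b. Vector_Spaces.linear sC sW (\<lambda>c. f a b c))"

type_synonym ('k, 'a, 'b) tensor = "('a \<Rightarrow> 'b \<Rightarrow> 'k) \<Rightarrow> 'k"
type_synonym ('k, 'a, 'b, 'c) tensor3 = "('a \<Rightarrow> 'b \<Rightarrow> 'c \<Rightarrow> 'k) \<Rightarrow> 'k"

definition fscale :: "'k::field \<Rightarrow> ('z \<Rightarrow> 'k) \<Rightarrow> ('z \<Rightarrow> 'k)" where
  "fscale c t = (\<lambda>\<beta>. c * t \<beta>)"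

definition tens ::
  "('k::field \<Rightarrow> 'a::ab_group_add \<Rightarrow> 'a) \<Rightarrow> ('k \<Rightarrow> 'b::ab_group_add \<Rightarrow> 'b) \<Rightarrow>
   'a \<Rightarrow> 'b \<Rightarrow> ('k, 'a, 'b) tensor" where
  "tens sA sB a b = (\<lambda>\<beta>. if bilinear_map sA sB (*) \<beta> then \<beta> a b else 0)"

definition tens3 ::
  "('k::field \<Rightarrow> 'a::ab_group_add \<Rightarrow> 'a) \<Rightarrow> ('k \<Rightarrow> 'b::ab_group_add \<Rightarrow> 'b) \<Rightarrow>
   ('k \<Rightarrow> 'c::ab_group_add \<Rightarrow> 'c) \<Rightarrow> 'a \<Rightarrow> 'b \<Rightarrow> 'c \<Rightarrow> ('k, 'a, 'b, 'c) tensor3" where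
  "tens3 sA sB sC a b c = (\<lambda>\<beta>. if trilinear_map sA sB sC (*) \<beta> then \<beta> a b c else 0)"

definition tensor_space ::
  "('k::field \<Rightarrow> 'a::ab_group_add \<Rightarrow> 'a) \<Rightarrow> ('k \<Rightarrow> 'b::ab_group_add \<Rightarrow> 'b) \<Rightarrow>
   ('k, 'a, 'b) tensor set" where
  "tensor_space sA sB = module.span fscale {tens sA sB a b | a b. True}"

definition tensor3_space ::
  "('k::field \<Rightarrow> 'a::ab_group_add \<Rightarrow> 'a) \<Rightarrow> ('k \<Rightarrow> 'b::ab_group_add \<Rightarrow> 'b) \<Rightarrow>
   ('k \<Rightarrow> 'c::ab_group_add \<Rightarrow> 'c) \<Rightarrow> ('k, 'a, 'b, 'c) tensor3 set" where
  "tensor3_space sA sB sC = module.span fscale {tens3 sA sB sC a b c | a b c. True}"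

text \<open>
  For bilinear \<open>F\<close>, \<open>sweedler t F\<close> is the value at \<open>t\<close> of the linear map with \<open>u \<otimes> v \<mapsto> F u v\<close>
  (\<open>sweedler_tens\<close>, \<open>linear_sweedler\<close>). So \<open>sweedler (\<Delta> a) (\<lambda>a1 a2. F a1 a2)\<close> is what Sigma
  notation writes as \<open>F a\<^sub>1 a\<^sub>2\<close> with \<open>\<Delta> a = a\<^sub>1 \<otimes> a\<^sub>2\<close>.
\<close>

definition sweedler :: "('k, 'a, 'b) tensor \<Rightarrow> ('a \<Rightarrow> 'b \<Rightarrow> ('z \<Rightarrow> 'k)) \<Rightarrow> ('z \<Rightarrow> 'k)" where
  "sweedler t F = (\<lambda>\<beta>. t (\<lambda>u v. F u v \<beta>))"

definition twist :: "('k, 'a, 'b) tensor \<Rightarrow> ('k, 'b, 'a) tensor" where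
  "twist t = (\<lambda>\<beta>. t (\<lambda>u v. \<beta> v u))"

definition twist13 :: "('k, 'a, 'b, 'c) tensor3 \<Rightarrow> ('k, 'c, 'b, 'a) tensor3" where
  "twist13 t = (\<lambda>\<beta>. t (\<lambda>u v w. \<beta> w v u))"

definition id_minus_twist :: "('k::field, 'a, 'a) tensor \<Rightarrow> ('k, 'a, 'a) tensor" where
  "id_minus_twist t = t - twist t"

text \<open>
  \<open>(f \<otimes> id) t\<close> and \<open>(id \<otimes> f) t\<close> in \<open>X \<otimes> Y \<otimes> Z\<close>, where \<open>f\<close> has values in \<open>X \<otimes> Y\<close>,
  respectively \<open>Y \<otimes> Z\<close>.
\<close>

definition tensor_id ::
  "('k::field \<Rightarrow> 'x::ab_group_add \<Rightarrow> 'x) \<Rightarrow> ('k \<Rightarrow> 'y::ab_group_add \<Rightarrow> 'y) \<Rightarrow>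
   ('k \<Rightarrow> 'z::ab_group_add \<Rightarrow> 'z) \<Rightarrow> ('u \<Rightarrow> ('k, 'x, 'y) tensor) \<Rightarrow>
   ('k, 'u, 'z) tensor \<Rightarrow> ('k, 'x, 'y, 'z) tensor3" where
  "tensor_id sX sY sZ f t = sweedler t (\<lambda>u z. sweedler (f u) (\<lambda>x y. tens3 sX sY sZ x y z))"

definition id_tensor ::
  "('k::field \<Rightarrow> 'x::ab_group_add \<Rightarrow> 'x) \<Rightarrow> ('k \<Rightarrow> 'y::ab_group_add \<Rightarrow> 'y) \<Rightarrow>
   ('k \<Rightarrow> 'z::ab_group_add \<Rightarrow> 'z) \<Rightarrow> ('u \<Rightarrow> ('k, 'y, 'z) tensor) \<Rightarrow>
   ('k, 'x, 'u) tensor \<Rightarrow> ('k, 'x, 'y, 'z) tensor3" where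
  "id_tensor sX sY sZ f t = sweedler t (\<lambda>x u. sweedler (f u) (\<lambda>y z. tens3 sX sY sZ x y z))"

definition linear_to_tensor ::
  "('k::field \<Rightarrow> 'u::ab_group_add \<Rightarrow> 'u) \<Rightarrow> ('k \<Rightarrow> 'a::ab_group_add \<Rightarrow> 'a) \<Rightarrow>
   ('k \<Rightarrow> 'b::ab_group_add \<Rightarrow> 'b) \<Rightarrow> ('u \<Rightarrow> ('k, 'a, 'b) tensor) \<Rightarrow> bool" where
  "linear_to_tensor sU sA sB f \<longleftrightarrow>
     Vector_Spaces.linear sU fscale f \<and> (\<forall>u. f u \<in> tensor_space sA sB)"

subsection \<open>Universal property\<close>

lemma vector_space_fscale: "vector_space (fscale :: 'k::field \<Rightarrow> ('z \<Rightarrow> 'k) \<Rightarrow> _)"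
  by unfold_locales (auto simp: fscale_def algebra_simps fun_eq_iff)

lemma vector_space_times: "vector_space ((*) :: 'k::field \<Rightarrow> 'k \<Rightarrow> 'k)"
  by unfold_locales (auto simp: algebra_simps)

lemma linear_eval: "Vector_Spaces.linear fscale (*) (\<lambda>t :: 'z \<Rightarrow> 'k::field. t \<beta>)"
  unfolding Vector_Spaces.linear_iff
  by (auto simp: fscale_def vector_space_fscale vector_space_times)

lemma linear_comp:
  assumes "Vector_Spaces.linear s1 s2 f" "Vector_Spaces.linear s2 s3 g"
  shows "Vector_Spaces.linear s1 s3 (\<lambda>x. g (f x))"
  using Vector_Spaces.linear_compose[OF assms] by (simp add: o_def)

lemma linear_functionals_separate:
  fixes s :: "'k::field \<Rightarrow> 'w::ab_group_add \<Rightarrow> 'w"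
  assumes "vector_space s" and "\<And>l. Vector_Spaces.linear s (*) l \<Longrightarrow> l x = l y"
  shows "x = y"
proof (rule ccontr)
  assume "x \<noteq> y"
  interpret vector_space_pair s "(*)"
    using assms(1) vector_space_times by (simp add: vector_space_pair_def)
  have "vs1.independent {x - y}"
    using \<open>x \<noteq> y\<close> by (simp add: vs1.dependent_single)
  from linear_independent_extend[OF this, of "\<lambda>_. 1"]
  obtain l where l: "Vector_Spaces.linear s (*) l" "l (x - y) = 1"
    by auto
  then show False
    using assms(2)[OF l(1)] linear_diff[OF l(1), of x y] by simp
qed

lemma evaluation_universal:
  fixes \<delta> :: "'x \<Rightarrow> 'z \<Rightarrow> 'k::field" and F :: "'x \<Rightarrow> 'w::ab_group_add"
  assumes s: "vector_space s"
    and *: "\<And>l. Vector_Spaces.linear s (*) l \<Longrightarrow> \<exists>\<beta>. \<forall>x. \<delta> x \<beta> = l (F x)"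
  shows "\<exists>L. Vector_Spaces.linear fscale s L \<and> (\<forall>x. L (\<delta> x) = F x)"
proof -
  interpret vector_space_pair "fscale :: 'k \<Rightarrow> ('z \<Rightarrow> 'k) \<Rightarrow> _" s
    using s vector_space_fscale by (simp add: vector_space_pair_def)
  obtain B where B: "B \<subseteq> range \<delta>" "vs1.independent B" "range \<delta> \<subseteq> vs1.span B"
    using vs1.maximal_independent_subset by blast
  define r where "r b = (SOME x. \<delta> x = b)" for b
  have r: "\<delta> (r b) = b" if "b \<in> B" for b
    using that B(1) unfolding r_def by (metis (mono_tags) imageE someI subsetD)
  obtain L where L: "Vector_Spaces.linear fscale s L" "\<And>b. b \<in> B \<Longrightarrow> L b = F (r b)"
    using linear_independent_extend[OF B(2), of "\<lambda>b. F (r b)"] by auto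
  have "L (\<delta> x) = F x" for x
  proof (rule linear_functionals_separate[OF s])
    fix l assume l: "Vector_Spaces.linear s (*) l"
    then obtain \<beta> where \<beta>: "\<And>x. \<delta> x \<beta> = l (F x)"
      using * by blast
    interpret q: vector_space_pair "fscale :: 'k \<Rightarrow> ('z \<Rightarrow> 'k) \<Rightarrow> _" "(*) :: 'k \<Rightarrow> _"
      using vector_space_times vector_space_fscale by (simp add: vector_space_pair_def)
    have "l (L (\<delta> x)) = \<delta> x \<beta>"
    proof (rule q.linear_eq_on[OF linear_comp[OF L(1) l] linear_eval])
      show "\<delta> x \<in> vs1.span B"
        using B(3) by blast
      show "l (L b) = b \<beta>" if "b \<in> B" for b
        using L(2)[OF that] \<beta>[of "r b"] r[OF that] by simp
    qed
    then show "l (L (\<delta> x)) = l (F x)"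
      by (simp add: \<beta>)
  qed
  with L(1) show ?thesis
    by blast
qed

lemma bilinear_tens:
  assumes "vector_space sA" "vector_space sB"
  shows "bilinear_map sA sB fscale (tens sA sB)"
  using assms unfolding bilinear_map_def Vector_Spaces.linear_iff
  by (auto simp: vector_space_fscale tens_def fscale_def fun_eq_iff bilinear_map_def
      Vector_Spaces.linear_iff)

lemma trilinear_tens3:
  assumes "vector_space sA" "vector_space sB" "vector_space sC"
  shows "trilinear_map sA sB sC fscale (tens3 sA sB sC)"
  using assms unfolding trilinear_map_def Vector_Spaces.linear_iff
  by (auto simp: vector_space_fscale tens3_def fscale_def fun_eq_iff trilinear_map_def
      Vector_Spaces.linear_iff)

theorem tens_universal:
  assumes F: "bilinear_map sA sB sW F"
  shows "\<exists>L. Vector_Spaces.linear fscale sW L \<and> (\<forall>a b. L (tens sA sB a b) = F a b)"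
proof -
  have "vector_space sW"
    using F by (simp add: bilinear_map_def Vector_Spaces.linear_iff)
  moreover have "\<exists>\<beta>. \<forall>x. case_prod (tens sA sB) x \<beta> = l (case_prod F x)"
    if "Vector_Spaces.linear sW (*) l" for l
  proof -
    have "bilinear_map sA sB (*) (\<lambda>a b. l (F a b))"
      unfolding bilinear_map_def
      by (intro conjI allI linear_comp[OF _ that]) (use F in \<open>auto simp: bilinear_map_def\<close>)
    then show ?thesis
      by (intro exI[of _ "\<lambda>a b. l (F a b)"]) (auto simp: tens_def)
  qed
  ultimately show ?thesis
    using evaluation_universal[of sW "case_prod (tens sA sB)" "case_prod F"] by fastforce
qed

theorem tens3_universal:
  assumes F: "trilinear_map sA sB sC sW F"
  shows "\<exists>L. Vector_Spaces.linear fscale sW L \<and> (\<forall>a b c. L (tens3 sA sB sC a b c) = F a b c)"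
proof -
  let ?t = "\<lambda>(a, b, c). tens3 sA sB sC a b c" and ?F = "\<lambda>(a, b, c). F a b c"
  have "vector_space sW"
    using F by (simp add: trilinear_map_def Vector_Spaces.linear_iff)
  moreover have "\<exists>\<beta>. \<forall>x. ?t x \<beta> = l (?F x)" if "Vector_Spaces.linear sW (*) l" for l
  proof -
    have "trilinear_map sA sB sC (*) (\<lambda>a b c. l (F a b c))"
      unfolding trilinear_map_def
      by (intro conjI allI linear_comp[OF _ that]) (use F in \<open>auto simp: trilinear_map_def\<close>)
    then show ?thesis
      by (intro exI[of _ "\<lambda>a b c. l (F a b c)"]) (auto simp: tens3_def)
  qed
  ultimately show ?thesis
    using evaluation_universal[of sW ?t ?F] by fastforce
qed

lemma linear_eq_on_tensor_space:
  fixes L :: "('k::field, 'a::ab_group_add, 'b::ab_group_add) tensor \<Rightarrow> 'w::ab_group_add"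
    and sW :: "'k \<Rightarrow> 'w \<Rightarrow> 'w"
  assumes "Vector_Spaces.linear fscale sW L" "Vector_Spaces.linear fscale sW L'"
    and "\<And>a b. L (tens sA sB a b) = L' (tens sA sB a b)" and "t \<in> tensor_space sA sB"
  shows "L t = L' t"
proof -
  interpret vector_space_pair "fscale :: 'k \<Rightarrow> ('k, 'a, 'b) tensor \<Rightarrow> _" sW
    using assms(1) by (simp add: Vector_Spaces.linear_iff vector_space_pair_def)
  show ?thesis
    using linear_eq_on[OF assms(1,2) assms(4)[unfolded tensor_space_def]] assms(3) by blast
qed

lemma linear_eq_on_tensor3_space:
  fixes L :: "('k::field, 'a::ab_group_add, 'b::ab_group_add, 'c::ab_group_add) tensor3 \<Rightarrow> 'w::ab_group_add"
    and sW :: "'k \<Rightarrow> 'w \<Rightarrow> 'w"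
  assumes "Vector_Spaces.linear fscale sW L" "Vector_Spaces.linear fscale sW L'"
    and "\<And>a b c. L (tens3 sA sB sC a b c) = L' (tens3 sA sB sC a b c)"
    and "t \<in> tensor3_space sA sB sC"
  shows "L t = L' t"
proof -
  interpret vector_space_pair "fscale :: 'k \<Rightarrow> ('k, 'a, 'b, 'c) tensor3 \<Rightarrow> _" sW
    using assms(1) by (simp add: Vector_Spaces.linear_iff vector_space_pair_def)
  show ?thesis
    using linear_eq_on[OF assms(1,2) assms(4)[unfolded tensor3_space_def]] assms(3) by blast
qed

lemma sweedler_tens:
  assumes "bilinear_map sA sB fscale F"
  shows "sweedler (tens sA sB a b) F = F a b"
proof
  fix \<beta>
  have "bilinear_map sA sB (*) (\<lambda>u v. F u v \<beta>)"
    unfolding bilinear_map_def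
  proof (intro conjI allI)
    show "Vector_Spaces.linear sA (*) (\<lambda>u. F u v \<beta>)" for v
      using assms linear_comp[of sA fscale "\<lambda>u. F u v", OF _ linear_eval[of \<beta>]]
      by (simp add: bilinear_map_def)
    show "Vector_Spaces.linear sB (*) (\<lambda>v. F u v \<beta>)" for u
      using assms linear_comp[of sB fscale "F u", OF _ linear_eval[of \<beta>]]
      by (simp add: bilinear_map_def)
  qed
  then show "sweedler (tens sA sB a b) F \<beta> = F a b \<beta>"
    by (simp add: sweedler_def tens_def)
qed

lemma linear_sweedler:
  "Vector_Spaces.linear fscale fscale (\<lambda>t :: ('k::field, 'a, 'b) tensor. sweedler t F)"
  unfolding Vector_Spaces.linear_iff
  by (auto simp: sweedler_def fscale_def vector_space_fscale fun_eq_iff)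

lemma twist_tens: "twist (tens sA sB a b) = tens sB sA b a"
  by (auto simp: twist_def tens_def bilinear_map_def fun_eq_iff)

lemma twist13_tens3: "twist13 (tens3 sA sB sC a b c) = tens3 sC sB sA c b a"
  by (auto simp: twist13_def tens3_def trilinear_map_def fun_eq_iff)

section \<open>Anti-flexible bialgebras\<close>

locale anti_flexible_algebra = vector_space scale
  for scale :: "'k::field_char_0 \<Rightarrow> 'a::ab_group_add \<Rightarrow> 'a" +
  fixes mult :: "'a \<Rightarrow> 'a \<Rightarrow> 'a" (infixl "\<cdot>" 75)
  assumes bilinear_mult: "bilinear_map scale scale scale mult"
    and anti_flexible: "(a \<cdot> b) \<cdot> c - a \<cdot> (b \<cdot> c) = (c \<cdot> b) \<cdot> a - c \<cdot> (b \<cdot> a)"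

locale anti_flexible_coalgebra = vector_space scale
  for scale :: "'k::field_char_0 \<Rightarrow> 'a::ab_group_add \<Rightarrow> 'a" +
  fixes \<Delta> :: "'a \<Rightarrow> ('k, 'a, 'a) tensor"
  assumes linear_comult: "linear_to_tensor scale scale scale \<Delta>"
    and anti_coflexible:
      "tensor_id scale scale scale \<Delta> (\<Delta> a) - id_tensor scale scale scale \<Delta> (\<Delta> a) =
       twist13 (tensor_id scale scale scale \<Delta> (\<Delta> a) - id_tensor scale scale scale \<Delta> (\<Delta> a))"

locale anti_flexible_algebra_coalgebra =
  anti_flexible_algebra scale mult + anti_flexible_coalgebra scale \<Delta>
  for scale :: "'k::field_char_0 \<Rightarrow> 'a::ab_group_add \<Rightarrow> 'a"
    and mult :: "'a \<Rightarrow> 'a \<Rightarrow> 'a" (infixl "\<cdot>" 75)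
    and \<Delta> :: "'a \<Rightarrow> ('k, 'a, 'a) tensor"
begin

abbreviation tens_self :: "'a \<Rightarrow> 'a \<Rightarrow> ('k, 'a, 'a) tensor" (infix "\<otimes>" 70) where
  "a \<otimes> b \<equiv> tens scale scale a b"

end

locale anti_flexible_bialgebra = anti_flexible_algebra_coalgebra scale mult \<Delta>
  for scale :: "'k::field_char_0 \<Rightarrow> 'a::ab_group_add \<Rightarrow> 'a"
    and mult :: "'a \<Rightarrow> 'a \<Rightarrow> 'a" (infixl "\<cdot>" 75)
    and \<Delta> :: "'a \<Rightarrow> ('k, 'a, 'a) tensor" +
  assumes comult_mult:
      "\<Delta> (a \<cdot> b) + twist (\<Delta> (b \<cdot> a)) =
         sweedler (\<Delta> a) (\<lambda>a1 a2. (a1 \<cdot> b) \<otimes> a2)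
       + sweedler (\<Delta> a) (\<lambda>a1 a2. (b \<cdot> a2) \<otimes> a1)
       + sweedler (\<Delta> b) (\<lambda>b1 b2. b1 \<otimes> (a \<cdot> b2))
       + sweedler (\<Delta> b) (\<lambda>b1 b2. b2 \<otimes> (b1 \<cdot> a))"
    and comult_mult_twist:
      "id_minus_twist
         (sweedler (\<Delta> a) (\<lambda>a1 a2. a1 \<otimes> (a2 \<cdot> b))
        + sweedler (\<Delta> b) (\<lambda>b1 b2. (a \<cdot> b1) \<otimes> b2)
        - sweedler (\<Delta> a) (\<lambda>a1 a2. (b \<cdot> a1) \<otimes> a2)
        - sweedler (\<Delta> b) (\<lambda>b1 b2. b1 \<otimes> (b2 \<cdot> a))) = 0"

section \<open>Anti-flexible Hopf bimodules\<close>

locale anti_flexible_bimodule =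
  H: anti_flexible_bialgebra sH mH \<Delta>H + V: vector_space sV
  for sH :: "'k::field_char_0 \<Rightarrow> 'h::ab_group_add \<Rightarrow> 'h"
    and mH :: "'h \<Rightarrow> 'h \<Rightarrow> 'h" (infixl "\<cdot>\<^sub>H" 75)
    and \<Delta>H :: "'h \<Rightarrow> ('k, 'h, 'h) tensor"
    and sV :: "'k \<Rightarrow> 'v::ab_group_add \<Rightarrow> 'v" +
  fixes lact :: "'h \<Rightarrow> 'v \<Rightarrow> 'v" (infixr "\<triangleright>" 75)
    and ract :: "'v \<Rightarrow> 'h \<Rightarrow> 'v" (infixl "\<triangleleft>" 75)
  assumes bilinear_lact: "bilinear_map sH sV sV lact"
    and bilinear_ract: "bilinear_map sV sH sV ract"
    and lact_mult: "(x \<cdot>\<^sub>H y) \<triangleright> v - x \<triangleright> (y \<triangleright> v) = (v \<triangleleft> y) \<triangleleft> x - v \<triangleleft> (y \<cdot>\<^sub>H x)"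
    and lact_ract: "(x \<triangleright> v) \<triangleleft> y - x \<triangleright> (v \<triangleleft> y) = (y \<triangleright> v) \<triangleleft> x - y \<triangleright> (v \<triangleleft> x)"

locale anti_flexible_bicomodule =
  H: anti_flexible_bialgebra sH mH \<Delta>H + V: vector_space sV
  for sH :: "'k::field_char_0 \<Rightarrow> 'h::ab_group_add \<Rightarrow> 'h"
    and mH :: "'h \<Rightarrow> 'h \<Rightarrow> 'h" (infixl "\<cdot>\<^sub>H" 75)
    and \<Delta>H :: "'h \<Rightarrow> ('k, 'h, 'h) tensor"
    and sV :: "'k \<Rightarrow> 'v::ab_group_add \<Rightarrow> 'v" +
  fixes \<phi> :: "'v \<Rightarrow> ('k, 'h, 'v) tensor"
    and \<psi> :: "'v \<Rightarrow> ('k, 'v, 'h) tensor"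
  assumes linear_lcoact: "linear_to_tensor sV sH sV \<phi>"
    and linear_rcoact: "linear_to_tensor sV sV sH \<psi>"
    and lcoact_comult:
      "tensor_id sH sH sV \<Delta>H (\<phi> v) - id_tensor sH sH sV \<phi> (\<phi> v) =
       twist13 (tensor_id sV sH sH \<psi> (\<psi> v) - id_tensor sV sH sH \<Delta>H (\<psi> v))"
    and lcoact_rcoact:
      "tensor_id sH sV sH \<phi> (\<psi> v) - id_tensor sH sV sH \<psi> (\<phi> v) =
       twist13 (tensor_id sH sV sH \<phi> (\<psi> v) - id_tensor sH sV sH \<psi> (\<phi> v))"

locale anti_flexible_Hopf_bimodule =
  anti_flexible_bimodule sH mH \<Delta>H sV lact ract + anti_flexible_bicomodule sH mH \<Delta>H sV \<phi> \<psi>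
  for sH :: "'k::field_char_0 \<Rightarrow> 'h::ab_group_add \<Rightarrow> 'h"
    and mH :: "'h \<Rightarrow> 'h \<Rightarrow> 'h" (infixl "\<cdot>\<^sub>H" 75)
    and \<Delta>H :: "'h \<Rightarrow> ('k, 'h, 'h) tensor"
    and sV :: "'k \<Rightarrow> 'v::ab_group_add \<Rightarrow> 'v"
    and lact :: "'h \<Rightarrow> 'v \<Rightarrow> 'v" (infixr "\<triangleright>" 75)
    and ract :: "'v \<Rightarrow> 'h \<Rightarrow> 'v" (infixl "\<triangleleft>" 75)
    and \<phi> :: "'v \<Rightarrow> ('k, 'h, 'v) tensor"
    and \<psi> :: "'v \<Rightarrow> ('k, 'v, 'h) tensor" +
  assumes lcoact_act:
      "\<phi> (x \<triangleright> v) + twist (\<psi> (v \<triangleleft> x)) =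
         sweedler (\<phi> v) (\<lambda>h w. tens sH sV h (x \<triangleright> w))
       + sweedler (\<psi> v) (\<lambda>w h. tens sH sV h (w \<triangleleft> x))"
    and rcoact_act:
      "\<psi> (x \<triangleright> v) + twist (\<phi> (v \<triangleleft> x)) =
         sweedler (\<Delta>H x) (\<lambda>x1 x2. tens sV sH (x1 \<triangleright> v) x2)
       + sweedler (\<psi> v) (\<lambda>w h. tens sV sH w (x \<cdot>\<^sub>H h))
       + sweedler (\<phi> v) (\<lambda>h w. tens sV sH w (h \<cdot>\<^sub>H x))
       + sweedler (\<Delta>H x) (\<lambda>x1 x2. tens sV sH (v \<triangleleft> x2) x1)"
    and coact_act_twist:
      "sweedler (\<psi> v) (\<lambda>w h. tens sV sH (x \<triangleright> w) h)
       - sweedler (\<Delta>H x) (\<lambda>x1 x2. tens sV sH (v \<triangleleft> x1) x2)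
       - sweedler (\<psi> v) (\<lambda>w h. tens sV sH w (h \<cdot>\<^sub>H x)) =
       twist
        (sweedler (\<phi> v) (\<lambda>h w. tens sH sV (x \<cdot>\<^sub>H h) w)
         + sweedler (\<Delta>H x) (\<lambda>x1 x2. tens sH sV x1 (x2 \<triangleright> v))
         - sweedler (\<phi> v) (\<lambda>h w. tens sH sV h (w \<triangleleft> x)))"

section \<open>Algebras, coalgebras and braided bialgebras in the category of Hopf bimodules\<close>

locale anti_flexible_algebra_coalgebra_in_Hopf_bimodules =
  anti_flexible_Hopf_bimodule sH mH \<Delta>H sA lact ract \<phi> \<psi> +
  A: anti_flexible_algebra_coalgebra sA mA \<Delta>A
  for sH :: "'k::field_char_0 \<Rightarrow> 'h::ab_group_add \<Rightarrow> 'h"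
    and mH :: "'h \<Rightarrow> 'h \<Rightarrow> 'h" (infixl "\<cdot>\<^sub>H" 75)
    and \<Delta>H :: "'h \<Rightarrow> ('k, 'h, 'h) tensor"
    and sA :: "'k \<Rightarrow> 'a::ab_group_add \<Rightarrow> 'a"
    and mA :: "'a \<Rightarrow> 'a \<Rightarrow> 'a" (infixl "\<cdot>" 75)
    and \<Delta>A :: "'a \<Rightarrow> ('k, 'a, 'a) tensor"
    and lact :: "'h \<Rightarrow> 'a \<Rightarrow> 'a" (infixr "\<triangleright>" 75)
    and ract :: "'a \<Rightarrow> 'h \<Rightarrow> 'a" (infixl "\<triangleleft>" 75)
    and \<phi> :: "'a \<Rightarrow> ('k, 'h, 'a) tensor"
    and \<psi> :: "'a \<Rightarrow> ('k, 'a, 'h) tensor" +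
  assumes bimodule_algebra1:
      "(x \<triangleright> a) \<cdot> b - x \<triangleright> (a \<cdot> b) = (b \<cdot> a) \<triangleleft> x - b \<cdot> (a \<triangleleft> x)"
    and bimodule_algebra2:
      "a \<cdot> (x \<triangleright> b) - (a \<triangleleft> x) \<cdot> b = b \<cdot> (x \<triangleright> a) - (b \<triangleleft> x) \<cdot> a"
    and bicomodule_coalgebra1:
      "tensor_id sH sA sA \<phi> (\<Delta>A a) - id_tensor sH sA sA \<Delta>A (\<phi> a) =
       twist13 (tensor_id sA sA sH \<Delta>A (\<psi> a) - id_tensor sA sA sH \<psi> (\<Delta>A a))"
    and bicomodule_coalgebra2:
      "tensor_id sA sH sA \<psi> (\<Delta>A a) - id_tensor sA sH sA \<phi> (\<Delta>A a) =
       twist13 (tensor_id sA sH sA \<psi> (\<Delta>A a) - id_tensor sA sH sA \<phi> (\<Delta>A a))"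
    and bicomodule_algebra1:
      "\<phi> (a \<cdot> b) + twist (\<psi> (b \<cdot> a)) =
         sweedler (\<phi> b) (\<lambda>h b0. tens sH sA h (a \<cdot> b0))
       + sweedler (\<psi> b) (\<lambda>b0 h. tens sH sA h (b0 \<cdot> a))"
    and bicomodule_algebra2:
      "sweedler (\<phi> a) (\<lambda>h a0. tens sH sA h (a0 \<cdot> b))
       - sweedler (\<phi> b) (\<lambda>h b0. tens sH sA h (b0 \<cdot> a)) =
       twist
        (sweedler (\<psi> b) (\<lambda>b0 h. tens sA sH (a \<cdot> b0) h)
         - sweedler (\<psi> a) (\<lambda>a0 h. tens sA sH (b \<cdot> a0) h))"
    and bimodule_coalgebra1:
      "\<Delta>A (x \<triangleright> b) + twist (\<Delta>A (b \<triangleleft> x)) =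
         sweedler (\<Delta>A b) (\<lambda>b1 b2. tens sA sA b2 (b1 \<triangleleft> x))
       + sweedler (\<Delta>A b) (\<lambda>b1 b2. tens sA sA b1 (x \<triangleright> b2))"
    and bimodule_coalgebra2:
      "id_minus_twist
         (sweedler (\<Delta>A b) (\<lambda>b1 b2. tens sA sA (x \<triangleright> b1) b2)
        - sweedler (\<Delta>A b) (\<lambda>b1 b2. tens sA sA b1 (b2 \<triangleleft> x))) = 0"

locale braided_anti_flexible_bialgebra =
  anti_flexible_algebra_coalgebra_in_Hopf_bimodules sH mH \<Delta>H sA mA \<Delta>A lact ract \<phi> \<psi>
  for sH :: "'k::field_char_0 \<Rightarrow> 'h::ab_group_add \<Rightarrow> 'h"
    and mH :: "'h \<Rightarrow> 'h \<Rightarrow> 'h" (infixl "\<cdot>\<^sub>H" 75)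
    and \<Delta>H :: "'h \<Rightarrow> ('k, 'h, 'h) tensor"
    and sA :: "'k \<Rightarrow> 'a::ab_group_add \<Rightarrow> 'a"
    and mA :: "'a \<Rightarrow> 'a \<Rightarrow> 'a" (infixl "\<cdot>" 75)
    and \<Delta>A :: "'a \<Rightarrow> ('k, 'a, 'a) tensor"
    and lact :: "'h \<Rightarrow> 'a \<Rightarrow> 'a" (infixr "\<triangleright>" 75)
    and ract :: "'a \<Rightarrow> 'h \<Rightarrow> 'a" (infixl "\<triangleleft>" 75)
    and \<phi> :: "'a \<Rightarrow> ('k, 'h, 'a) tensor"
    and \<psi> :: "'a \<Rightarrow> ('k, 'a, 'h) tensor" +
  assumes braided_comult_mult:
      "\<Delta>A (a \<cdot> b) + twist (\<Delta>A (b \<cdot> a)) =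
         sweedler (\<Delta>A a) (\<lambda>a1 a2. tens sA sA (a1 \<cdot> b) a2)
       + sweedler (\<Delta>A a) (\<lambda>a1 a2. tens sA sA (b \<cdot> a2) a1)
       + sweedler (\<Delta>A b) (\<lambda>b1 b2. tens sA sA b1 (a \<cdot> b2))
       + sweedler (\<Delta>A b) (\<lambda>b1 b2. tens sA sA b2 (b1 \<cdot> a))
       + sweedler (\<phi> a) (\<lambda>h a0. tens sA sA (h \<triangleright> b) a0)
       + sweedler (\<psi> a) (\<lambda>a0 h. tens sA sA (b \<triangleleft> h) a0)
       + sweedler (\<psi> b) (\<lambda>b0 h. tens sA sA b0 (a \<triangleleft> h))
       + sweedler (\<phi> b) (\<lambda>h b0. tens sA sA b0 (h \<triangleright> a))"
    and braided_comult_mult_twist: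
      "id_minus_twist
         (sweedler (\<Delta>A a) (\<lambda>a1 a2. tens sA sA a1 (a2 \<cdot> b))
        - sweedler (\<Delta>A a) (\<lambda>a1 a2. tens sA sA (b \<cdot> a1) a2)
        - sweedler (\<Delta>A b) (\<lambda>b1 b2. tens sA sA b1 (b2 \<cdot> a))
        + sweedler (\<Delta>A b) (\<lambda>b1 b2. tens sA sA (a \<cdot> b1) b2))
       + id_minus_twist
         (sweedler (\<psi> a) (\<lambda>a0 h. tens sA sA a0 (h \<triangleright> b))
        - sweedler (\<phi> a) (\<lambda>h a0. tens sA sA (b \<triangleleft> h) a0)
        - sweedler (\<psi> b) (\<lambda>b0 h. tens sA sA b0 (h \<triangleright> a))
        + sweedler (\<phi> b) (\<lambda>h b0. tens sA sA (a \<triangleleft> h) b0)) = 0"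

section \<open>The biproduct\<close>

definition biproduct_mult ::
  "('h \<Rightarrow> 'h \<Rightarrow> 'h) \<Rightarrow> ('a::ab_group_add \<Rightarrow> 'a \<Rightarrow> 'a) \<Rightarrow>
   ('h \<Rightarrow> 'a \<Rightarrow> 'a) \<Rightarrow> ('a \<Rightarrow> 'h \<Rightarrow> 'a) \<Rightarrow> 'a \<times> 'h \<Rightarrow> 'a \<times> 'h \<Rightarrow> 'a \<times> 'h" where
  "biproduct_mult mH mA lact ract =
     (\<lambda>(a, x) (b, y). (mA a b + lact x b + ract a y, mH x y))"

text \<open>
  In \<open>\<Delta>\<^sub>E (a, x) = \<Delta>\<^sub>A a + \<phi> a + \<psi> a + \<Delta>\<^sub>H x\<close> the four summands live in \<open>A \<otimes> A\<close>, \<open>H \<otimes> A\<close>,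
  \<open>A \<otimes> H\<close> and \<open>H \<otimes> H\<close>; they are mapped to \<open>E \<otimes> E\<close> by the inclusions of \<open>A\<close> and \<open>H\<close> in \<open>E\<close>.
\<close>

definition biproduct_comult ::
  "('k::field \<Rightarrow> 'h::ab_group_add \<Rightarrow> 'h) \<Rightarrow> ('h \<Rightarrow> ('k, 'h, 'h) tensor) \<Rightarrow>
   ('k \<Rightarrow> 'a::ab_group_add \<Rightarrow> 'a) \<Rightarrow> ('a \<Rightarrow> ('k, 'a, 'a) tensor) \<Rightarrow>
   ('a \<Rightarrow> ('k, 'h, 'a) tensor) \<Rightarrow> ('a \<Rightarrow> ('k, 'a, 'h) tensor) \<Rightarrow>
   'a \<times> 'h \<Rightarrow> ('k, 'a \<times> 'h, 'a \<times> 'h) tensor" where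
  "biproduct_comult sH \<Delta>H sA \<Delta>A \<phi> \<psi> =
     (\<lambda>(a, x). let sE = module_prod.scale sA sH in
         sweedler (\<Delta>A a) (\<lambda>a1 a2. tens sE sE (a1, 0) (a2, 0))
       + sweedler (\<phi> a) (\<lambda>h a0. tens sE sE (0, h) (a0, 0))
       + sweedler (\<psi> a) (\<lambda>a0 h. tens sE sE (a0, 0) (0, h))
       + sweedler (\<Delta>H x) (\<lambda>x1 x2. tens sE sE (0, x1) (0, x2)))"

end

(*
  A tensor is determined by its values on bilinear forms, and a bilinear form on E = A + H is a sum
  of forms on A x A, A x H, H x A and H x H. Evaluated on such forms, each anti-flexible bialgebra
  axiom for E splits into components. For associativity and coassociativity every component is an
  axiom of A, of H, of the (co)actions, or a bimodule algebra / bicomodule coalgebra condition. For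
  the two compatibility conditions the same holds for every component except the A x A one at two
  elements of A, where the cross terms of the comultiplication contribute exactly the extra terms
  of the braided conditions.
*)
theory Submission
  imports Defs
begin

section \<open>Tensors as functionals on multilinear forms\<close>

lemma bilinear_map_iff:
  "bilinear_map sA sB sW f \<longleftrightarrow> vector_space sA \<and> vector_space sB \<and> vector_space sW \<and>
     (\<forall>a a' b. f (a + a') b = f a b + f a' b) \<and> (\<forall>a b b'. f a (b + b') = f a b + f a b') \<and>
     (\<forall>c a b. f (sA c a) b = sW c (f a b)) \<and> (\<forall>c a b. f a (sB c b) = sW c (f a b))"
  unfolding bilinear_map_def Vector_Spaces.linear_iff by blast

lemma trilinear_map_iff:
  "trilinear_map sA sB sC sW f \<longleftrightarrow>
     vector_space sA \<and> vector_space sB \<and> vector_space sC \<and> vector_space sW \<and>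
     (\<forall>a a' b c. f (a + a') b c = f a b c + f a' b c) \<and>
     (\<forall>a b b' c. f a (b + b') c = f a b c + f a b' c) \<and>
     (\<forall>a b c c'. f a b (c + c') = f a b c + f a b c') \<and>
     (\<forall>r a b c. f (sA r a) b c = sW r (f a b c)) \<and>
     (\<forall>r a b c. f a (sB r b) c = sW r (f a b c)) \<and>
     (\<forall>r a b c. f a b (sC r c) = sW r (f a b c))"
  unfolding trilinear_map_def Vector_Spaces.linear_iff by (intro iffI) auto

lemma bilinear_mapD:
  assumes "bilinear_map sA sB sW f"
  shows "f (a + a') b = f a b + f a' b" "f a (b + b') = f a b + f a b'"
    "f (sA c a) b = sW c (f a b)" "f a (sB c b) = sW c (f a b)"
    "f 0 b = 0" "f a 0 = 0"
proof -
  have add: "f (a + a') b = f a b + f a' b" "f a (b + b') = f a b + f a b'" for a a' b b'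
    using assms by (simp_all add: bilinear_map_iff)
  then show "f (a + a') b = f a b + f a' b" "f a (b + b') = f a b + f a b'"
    by simp_all
  show "f 0 b = 0" "f a 0 = 0"
    using add(1)[of 0 0 b] add(2)[of a 0 0] by simp_all
  show "f (sA c a) b = sW c (f a b)" "f a (sB c b) = sW c (f a b)"
    using assms by (simp_all add: bilinear_map_iff)
qed

lemma trilinear_mapD:
  assumes "trilinear_map sA sB sC sW f"
  shows "f (a + a') b c = f a b c + f a' b c" "f a (b + b') c = f a b c + f a b' c"
    "f a b (c + c') = f a b c + f a b c'"
    "f (sA r a) b c = sW r (f a b c)" "f a (sB r b) c = sW r (f a b c)"
    "f a b (sC r c) = sW r (f a b c)"
  using assms by (simp_all add: trilinear_map_iff)

lemma bilinear_map_compose: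
  assumes "bilinear_map sA sB sW \<beta>" "Vector_Spaces.linear sC sA f" "Vector_Spaces.linear sD sB g"
  shows "bilinear_map sC sD sW (\<lambda>c d. \<beta> (f c) (g d))"
  using assms unfolding bilinear_map_iff Vector_Spaces.linear_iff by simp

lemma trilinear_map_compose:
  assumes "trilinear_map sA sB sC sW \<gamma>" "Vector_Spaces.linear sA' sA f"
    "Vector_Spaces.linear sB' sB g" "Vector_Spaces.linear sC' sC h"
  shows "trilinear_map sA' sB' sC' sW (\<lambda>a b c. \<gamma> (f a) (g b) (h c))"
  using assms unfolding trilinear_map_iff Vector_Spaces.linear_iff by simp

lemma bilinear_map_add:
  assumes "bilinear_map sX sY (*) f" "bilinear_map sX sY (*) g"
  shows "bilinear_map sX sY (*) (\<lambda>u v. f u v + g u v)"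
  using assms by (simp add: bilinear_map_iff algebra_simps)

text \<open>The last two variants exchange the arguments; they serve Sigma-notation terms such as
  \<open>(b \<cdot> a2) \<otimes> a1\<close>, in which the two legs of a comultiplication change
  places.\<close>

lemma bilinear_map_precompose:
  assumes "Vector_Spaces.linear sZ sX f"
  shows "bilinear_map sX sY sW \<beta> \<Longrightarrow> bilinear_map sZ sY sW (\<lambda>u v. \<beta> (f u) v)"
    "bilinear_map sY sX sW \<beta>' \<Longrightarrow> bilinear_map sY sZ sW (\<lambda>u v. \<beta>' u (f v))"
    "bilinear_map sX sY sW \<beta> \<Longrightarrow> bilinear_map sY sZ sW (\<lambda>u v. \<beta> (f v) u)"
    "bilinear_map sY sX sW \<beta>' \<Longrightarrow> bilinear_map sZ sY sW (\<lambda>u v. \<beta>' v (f u))"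
  using assms unfolding bilinear_map_iff Vector_Spaces.linear_iff by simp_all

section \<open>Tensors evaluated at bilinear forms\<close>

lemma tensor_space_0: "0 \<in> tensor_space sA sB"
  and tensor_space_tens: "tens sA sB a b \<in> tensor_space sA sB"
  and tensor_space_add:
    "s \<in> tensor_space sA sB \<Longrightarrow> t \<in> tensor_space sA sB \<Longrightarrow> s + t \<in> tensor_space sA sB"
  and tensor_space_scale: "t \<in> tensor_space sA sB \<Longrightarrow> fscale c t \<in> tensor_space sA sB"
  unfolding tensor_space_def
  by (blast intro: module.span_zero module.span_base module.span_add module.span_scale
      module_iff_vector_space[THEN iffD2] vector_space_fscale)+

text \<open>The predicate cuts out a subspace that contains all pure tensors, hence their span.
  Facts about evaluating a tensor at given forms thereby reduce to pure tensors.\<close>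

lemma tensor_space_induct [consumes 1, case_names zero tens add scale]:
  fixes t :: "('k::field, 'a::ab_group_add, 'b::ab_group_add) tensor"
  assumes "t \<in> tensor_space sA sB" and "P 0" and "\<And>a b. P (tens sA sB a b)"
    and "\<And>s t. P s \<Longrightarrow> P t \<Longrightarrow> P (s + t)" and "\<And>c t. P t \<Longrightarrow> P (fscale c t)"
  shows "P t"
proof -
  interpret vector_space "fscale :: 'k \<Rightarrow> ('k, 'a, 'b) tensor \<Rightarrow> _"
    by (rule vector_space_fscale)
  have "subspace (Collect P)"
    using assms by (simp add: subspace_def)
  then show ?thesis
    using span_induct[of t "{tens sA sB a b |a b. True}" P] assms(1,3)
    unfolding tensor_space_def by blast
qed

text \<open>Pure tensors are 0 there by convention, and sums and multiples inherit this. Equality of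
  tensors means equality at all functions, so such functions have to be covered as well.\<close>

lemma tensor_space_eval_not_bilinear:
  "t \<in> tensor_space sA sB \<Longrightarrow> \<not> bilinear_map sA sB (*) \<beta> \<Longrightarrow> t \<beta> = 0"
  by (induction t rule: tensor_space_induct) (auto simp: tens_def fscale_def)

text \<open>Additivity in the form is a matter of bilinear forms only: two functions that are not
  bilinear can have a bilinear sum, at which a tensor need not vanish.\<close>

lemma tensor_space_eval_add:
  assumes "t \<in> tensor_space sA sB" and \<beta>: "bilinear_map sA sB (*) \<beta>" "bilinear_map sA sB (*) \<beta>'"
  shows "t (\<lambda>a b. \<beta> a b + \<beta>' a b) = t \<beta> + t \<beta>'"
proof -
  have "bilinear_map sA sB (*) (\<lambda>a b. \<beta> a b + \<beta>' a b)"
    using \<beta> by (simp add: bilinear_map_iff algebra_simps)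
  with assms show ?thesis
    by (induction t rule: tensor_space_induct) (auto simp: tens_def fscale_def algebra_simps)
qed

lemma tensor_space_eval_scale:
  fixes \<beta> :: "'a::ab_group_add \<Rightarrow> 'b::ab_group_add \<Rightarrow> 'k::field"
  assumes "t \<in> tensor_space sA sB" and \<beta>: "bilinear_map sA sB (*) \<beta>"
  shows "t (\<lambda>a b. c * \<beta> a b) = c * t \<beta>"
proof -
  have "bilinear_map sA sB (*) (\<lambda>a b. c * \<beta> a b)"
    using \<beta> by (simp add: bilinear_map_iff algebra_simps)
  with assms show ?thesis
    by (induction t rule: tensor_space_induct) (auto simp: tens_def fscale_def algebra_simps)
qed

lemma tensor_space_eval_0:
  assumes "t \<in> tensor_space sA sB" shows "t (\<lambda>a b. 0) = 0"
  using assms by (induction t rule: tensor_space_induct) (auto simp: tens_def fscale_def)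

lemma sweedler_in_tensor_space:
  assumes t: "t \<in> tensor_space sA sB"
    and F: "bilinear_map sA sB fscale F" "\<And>a b. F a b \<in> tensor_space sC sD"
  shows "sweedler t F \<in> tensor_space sC sD"
  using t
proof (induction t rule: tensor_space_induct)
  case zero
  have "sweedler 0 F = 0"
    by (simp add: sweedler_def fun_eq_iff)
  then show ?case
    by (metis tensor_space_0)
next
  case (tens a b)
  then show ?case
    by (simp add: sweedler_tens[OF F(1)] F(2))
next
  case (add s t)
  moreover have "sweedler (s + t) F = sweedler s F + sweedler t F"
    by (simp add: sweedler_def fun_eq_iff)
  ultimately show ?case
    by (metis tensor_space_add)
next
  case (scale c t)
  moreover have "sweedler (fscale c t) F = fscale c (sweedler t F)"
    by (simp add: sweedler_def fscale_def fun_eq_iff)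
  ultimately show ?case
    by (metis tensor_space_scale)
qed

lemma bilinear_map_flip: "bilinear_map sB sA sW (\<lambda>b a. f a b) \<longleftrightarrow> bilinear_map sA sB sW f"
  unfolding bilinear_map_def by blast

lemma trilinear_map_flip13:
  "trilinear_map sC sB sA sW (\<lambda>c b a. f a b c) \<longleftrightarrow> trilinear_map sA sB sC sW f"
  unfolding trilinear_map_def by blast

text \<open>At forms that are not multilinear these evaluate as if the form were 0.\<close>

lemma sweedler_tens_eval:
  "sweedler t (\<lambda>u v. tens sC sD (F u v) (G u v)) \<beta> =
     (if bilinear_map sC sD (*) \<beta> then t (\<lambda>u v. \<beta> (F u v) (G u v)) else t (\<lambda>u v. 0))"
  by (simp add: sweedler_def tens_def)

lemma tensor_id_eval:
  "tensor_id sX sY sZ f t \<gamma> =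
     (if trilinear_map sX sY sZ (*) \<gamma> then t (\<lambda>u z. f u (\<lambda>x y. \<gamma> x y z))
      else t (\<lambda>u z. f u (\<lambda>x y. 0)))"
  by (simp add: tensor_id_def sweedler_def tens3_def)

lemma id_tensor_eval:
  "id_tensor sX sY sZ f t \<gamma> =
     (if trilinear_map sX sY sZ (*) \<gamma> then t (\<lambda>x u. f u (\<lambda>y z. \<gamma> x y z))
      else t (\<lambda>x u. f u (\<lambda>y z. 0)))"
  by (simp add: id_tensor_def sweedler_def tens3_def)

section \<open>Comultiplications and coactions evaluated at multilinear forms\<close>

lemma linear_to_tensorD:
  assumes "linear_to_tensor sU sA sB f"
  shows "f (u + v) = f u + f v" "f (sU c u) = fscale c (f u)" "f u \<in> tensor_space sA sB" "f 0 = 0"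
proof -
  have add: "f (u + v) = f u + f v" for u v
    using assms by (simp add: linear_to_tensor_def Vector_Spaces.linear_iff)
  show "f (u + v) = f u + f v" "f (sU c u) = fscale c (f u)" "f u \<in> tensor_space sA sB"
    using assms by (simp_all add: linear_to_tensor_def Vector_Spaces.linear_iff)
  show "f 0 = 0"
    using add[of 0 0] by simp
qed

text \<open>Linearity in \<open>u\<close> comes from \<open>f\<close>; linearity in \<open>z\<close>
  holds because the tensor \<open>f u\<close> is additive and homogeneous in the bilinear form it is
  applied to. Thus the inner evaluation of an iterated coproduct is again a legitimate form for the
  outer one.\<close>

lemma bilinear_tensor_id_form:
  assumes f: "linear_to_tensor sU sA sB f" and g: "trilinear_map sA sB sC (*) g"
  shows "bilinear_map sU sC (*) (\<lambda>u z. f u (\<lambda>x y. g x y z))"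
proof -
  have g': "bilinear_map sA sB (*) (\<lambda>x y. g x y z)" for z
    using g by (simp add: trilinear_map_def bilinear_map_def)
  note f' = linear_to_tensorD[OF f]
  have "vector_space sU" "vector_space sC"
    using f g by (simp_all add: linear_to_tensor_def Vector_Spaces.linear_iff trilinear_map_iff)
  then show ?thesis
    unfolding bilinear_map_iff
    by (simp add: f' fscale_def trilinear_mapD[OF g] vector_space_times
        tensor_space_eval_add[OF f'(3) g' g'] tensor_space_eval_scale[OF f'(3) g'])
qed

lemma bilinear_id_tensor_form:
  assumes f: "linear_to_tensor sU sA sB f" and g: "trilinear_map sC sA sB (*) g"
  shows "bilinear_map sC sU (*) (\<lambda>z u. f u (\<lambda>x y. g z x y))"
proof -
  have g': "bilinear_map sA sB (*) (\<lambda>x y. g z x y)" for z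
    using g by (simp add: trilinear_map_def bilinear_map_def)
  note f' = linear_to_tensorD[OF f]
  have "vector_space sU" "vector_space sC"
    using f g by (simp_all add: linear_to_tensor_def Vector_Spaces.linear_iff trilinear_map_iff)
  \<comment> \<open>The form in \<open>x\<close> and \<open>y\<close> is just the partial
    application \<open>g z\<close>, so linearity in \<open>z\<close> is stated for these partial
    applications.\<close>
  moreover have "f u (g (z + z')) = f u (g z) + f u (g z')" "f u (g (sC c z)) = c * f u (g z)"
    for u z z' c
    using tensor_space_eval_add[OF f'(3) g' g'] tensor_space_eval_scale[OF f'(3) g']
    by (simp_all add: trilinear_mapD[OF g, abs_def])
  ultimately show ?thesis
    unfolding bilinear_map_iff by (simp add: f' fscale_def vector_space_times)
qed

section \<open>Components of the biproduct\<close>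

context anti_flexible_algebra_coalgebra_in_Hopf_bimodules
begin

abbreviation sE :: "'k \<Rightarrow> 'a \<times> 'h \<Rightarrow> 'a \<times> 'h" where
  "sE \<equiv> module_prod.scale sA sH"

abbreviation mE :: "'a \<times> 'h \<Rightarrow> 'a \<times> 'h \<Rightarrow> 'a \<times> 'h" where
  "mE \<equiv> biproduct_mult mH mA lact ract"

abbreviation \<Delta>E :: "'a \<times> 'h \<Rightarrow> ('k, 'a \<times> 'h, 'a \<times> 'h) tensor" where
  "\<Delta>E \<equiv> biproduct_comult sH \<Delta>H sA \<Delta>A \<phi> \<psi>"

sublocale E: vector_space_prod sA sH
  by unfold_locales

lemma vector_space_biproduct: "vector_space sE"
  by (rule E.p.vector_space_axioms)

lemma scale_biproduct: "sE c (a, x) = (sA c a, sH c x)"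
  by (rule E.scale_prod)

lemma biproduct_mult_Pair: "mE (a, x) (b, y) = (a \<cdot> b + x \<triangleright> b + a \<triangleleft> y, x \<cdot>\<^sub>H y)"
  by (simp add: biproduct_mult_def)

lemmas structure_linear =
  bilinear_mapD[OF A.bilinear_mult] bilinear_mapD[OF H.bilinear_mult]
  bilinear_mapD[OF bilinear_lact] bilinear_mapD[OF bilinear_ract]
  linear_to_tensorD(1,2,4)[OF A.linear_comult] linear_to_tensorD(1,2,4)[OF H.linear_comult]
  linear_to_tensorD(1,2,4)[OF linear_lcoact] linear_to_tensorD(1,2,4)[OF linear_rcoact]

lemmas structure_in_tensor_space =
  linear_to_tensorD(3)[OF A.linear_comult] linear_to_tensorD(3)[OF H.linear_comult]
  linear_to_tensorD(3)[OF linear_lcoact] linear_to_tensorD(3)[OF linear_rcoact]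

lemmas structure_eval_add =
  structure_in_tensor_space[THEN tensor_space_eval_add]

lemmas structure_eval_0 =
  structure_in_tensor_space[THEN tensor_space_eval_0]

lemma bilinear_biproduct_mult: "bilinear_map sE sE sE mE"
  by (simp add: bilinear_map_iff vector_space_biproduct biproduct_mult_Pair scale_biproduct
      structure_linear split_paired_all V.scale_right_distrib add_ac)

lemma linear_inclusions:
  "Vector_Spaces.linear sA sE (\<lambda>a. (a, 0))" "Vector_Spaces.linear sH sE (\<lambda>x. (0, x))"
  by (simp_all add: Vector_Spaces.linear_iff vector_space_biproduct scale_biproduct
      V.vector_space_axioms H.vector_space_axioms)

lemma bilinear_form_biproduct_cases:
  assumes \<beta>: "bilinear_map sE sE (*) \<beta>"
  obtains \<beta>AA \<beta>AH \<beta>HA \<beta>HH where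
    "bilinear_map sA sA (*) \<beta>AA" "bilinear_map sA sH (*) \<beta>AH"
    "bilinear_map sH sA (*) \<beta>HA" "bilinear_map sH sH (*) \<beta>HH"
    "\<And>a x b y. \<beta> (a, x) (b, y) = \<beta>AA a b + \<beta>AH a y + \<beta>HA x b + \<beta>HH x y"
proof
  note add = bilinear_mapD(1,2)[OF \<beta>]
  \<comment> \<open>Proving the decomposition first fixes the four witnesses: they are the
    restrictions of \<open>\<beta>\<close> along the inclusions of A and H, which are
    linear.\<close>
  show "\<beta> (a, x) (b, y) = \<beta> (a, 0) (b, 0) + \<beta> (a, 0) (0, y) + \<beta> (0, x) (b, 0) + \<beta> (0, x) (0, y)"
    for a x b y
    using add(1)[of "(a, 0)" "(0, x)" "(b, y)"] add(2)[of "(a, 0)" "(b, 0)" "(0, y)"]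
      add(2)[of "(0, x)" "(b, 0)" "(0, y)"]
    by (simp add: algebra_simps)
qed (rule bilinear_map_compose[OF \<beta>]; rule linear_inclusions)+

lemmas bilinear_tens_biproduct =
  bilinear_map_compose[OF bilinear_tens[OF vector_space_biproduct vector_space_biproduct]
    linear_inclusions(1) linear_inclusions(1)]
  bilinear_map_compose[OF bilinear_tens[OF vector_space_biproduct vector_space_biproduct]
    linear_inclusions(1) linear_inclusions(2)]
  bilinear_map_compose[OF bilinear_tens[OF vector_space_biproduct vector_space_biproduct]
    linear_inclusions(2) linear_inclusions(1)]
  bilinear_map_compose[OF bilinear_tens[OF vector_space_biproduct vector_space_biproduct]
    linear_inclusions(2) linear_inclusions(2)]

lemma biproduct_comult_in_tensor_space: "\<Delta>E e \<in> tensor_space sE sE"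
  by (cases e) (auto simp: biproduct_comult_def Let_def intro!: tensor_space_add
      sweedler_in_tensor_space[OF _ bilinear_tens_biproduct(1)]
      sweedler_in_tensor_space[OF _ bilinear_tens_biproduct(2)]
      sweedler_in_tensor_space[OF _ bilinear_tens_biproduct(3)]
      sweedler_in_tensor_space[OF _ bilinear_tens_biproduct(4)]
      tensor_space_tens structure_in_tensor_space simp del: plus_fun_apply)

lemma linear_biproduct_comult: "linear_to_tensor sE sE sE \<Delta>E"
  by (simp add: linear_to_tensor_def Vector_Spaces.linear_iff vector_space_biproduct
      vector_space_fscale biproduct_comult_in_tensor_space split_paired_all scale_biproduct)
    (simp add: biproduct_comult_def Let_def structure_linear sweedler_def fscale_def fun_eq_iff
      algebra_simps)

lemma biproduct_comult_eval:
  "bilinear_map sE sE (*) \<beta> \<Longrightarrow>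
   \<Delta>E (a, x) \<beta> = \<Delta>A a (\<lambda>u v. \<beta> (u, 0) (v, 0)) + \<phi> a (\<lambda>h v. \<beta> (0, h) (v, 0))
     + \<psi> a (\<lambda>u h. \<beta> (u, 0) (0, h)) + \<Delta>H x (\<lambda>h k. \<beta> (0, h) (0, k))"
  by (simp add: biproduct_comult_def Let_def sweedler_tens_eval)

section \<open>The algebra structure of the biproduct\<close>

lemma anti_flexible_biproduct_mult: "anti_flexible_algebra sE mE"
proof
  show "bilinear_map sE sE sE mE"
    by (rule bilinear_biproduct_mult)
  show "mE (mE p q) r - mE p (mE q r) = mE (mE r q) p - mE r (mE q p)" for p q r
  proof -
    obtain a x b y c z where pqr: "p = (a, x)" "q = (b, y)" "r = (c, z)"
      by (metis surj_pair)
    \<comment> \<open>The A-component is regrouped into seven axiom defects, each zero by itself.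
      Exchanging \<open>p\<close> and \<open>r\<close> reverses the sign of the whole expression, so
      a condition at \<open>x\<close> reappears at \<open>z\<close> with the opposite sign.\<close>
    have "fst (mE (mE p q) r - mE p (mE q r)) - fst (mE (mE r q) p - mE r (mE q p)) =
      ((a \<cdot> b) \<cdot> c - a \<cdot> (b \<cdot> c) - ((c \<cdot> b) \<cdot> a - c \<cdot> (b \<cdot> a)))
      + ((x \<triangleright> b) \<cdot> c - x \<triangleright> (b \<cdot> c) - ((c \<cdot> b) \<triangleleft> x - c \<cdot> (b \<triangleleft> x)))
      - ((z \<triangleright> b) \<cdot> a - z \<triangleright> (b \<cdot> a) - ((a \<cdot> b) \<triangleleft> z - a \<cdot> (b \<triangleleft> z)))
      - (a \<cdot> (y \<triangleright> c) - (a \<triangleleft> y) \<cdot> c - (c \<cdot> (y \<triangleright> a) - (c \<triangleleft> y) \<cdot> a))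
      + ((x \<cdot>\<^sub>H y) \<triangleright> c - x \<triangleright> (y \<triangleright> c) - ((c \<triangleleft> y) \<triangleleft> x - c \<triangleleft> (y \<cdot>\<^sub>H x)))
      - ((z \<cdot>\<^sub>H y) \<triangleright> a - z \<triangleright> (y \<triangleright> a) - ((a \<triangleleft> y) \<triangleleft> z - a \<triangleleft> (y \<cdot>\<^sub>H z)))
      + ((x \<triangleright> b) \<triangleleft> z - x \<triangleright> (b \<triangleleft> z) - ((z \<triangleright> b) \<triangleleft> x - z \<triangleright> (b \<triangleleft> x)))"
      by (simp add: pqr biproduct_mult_Pair structure_linear algebra_simps)
    also have "\<dots> = 0"
      unfolding A.anti_flexible[of a b c] bimodule_algebra1[of x b c] bimodule_algebra2[of a y c]
        bimodule_algebra1[of z b a] lact_mult[of x y c] lact_ract[of x b z] lact_mult[of z y a]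
      by simp
    \<comment> \<open>Projection to H is multiplicative, so the second component is the
      anti-flexible law of H.\<close>
    finally show ?thesis
      using H.anti_flexible[of x y z] by (simp add: pqr biproduct_mult_Pair prod_eq_iff)
  qed
qed

lemmas linear_mult =
  A.bilinear_mult[unfolded bilinear_map_def, THEN conjunct1, rule_format]
  A.bilinear_mult[unfolded bilinear_map_def, THEN conjunct2, rule_format]
  H.bilinear_mult[unfolded bilinear_map_def, THEN conjunct1, rule_format]
  H.bilinear_mult[unfolded bilinear_map_def, THEN conjunct2, rule_format]
  bilinear_lact[unfolded bilinear_map_def, THEN conjunct1, rule_format]
  bilinear_lact[unfolded bilinear_map_def, THEN conjunct2, rule_format]
  bilinear_ract[unfolded bilinear_map_def, THEN conjunct1, rule_format]
  bilinear_ract[unfolded bilinear_map_def, THEN conjunct2, rule_format]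

text \<open>Certifies that a form stays bilinear after one argument is multiplied or acted on, in
  either order of the legs; splitting an evaluation at a sum of such forms requires this.\<close>

lemmas bilinear_form_mult =
  linear_mult[THEN bilinear_map_precompose(1)] linear_mult[THEN bilinear_map_precompose(2)]
  linear_mult[THEN bilinear_map_precompose(3)] linear_mult[THEN bilinear_map_precompose(4)]

lemmas linear_biproduct_mult =
  bilinear_biproduct_mult[unfolded bilinear_map_def, THEN conjunct1, rule_format]
  bilinear_biproduct_mult[unfolded bilinear_map_def, THEN conjunct2, rule_format]

section \<open>The coalgebra structure of the biproduct\<close>

lemmas structure_bilinear =
  bilinear_tensor_id_form[OF A.linear_comult] bilinear_id_tensor_form[OF A.linear_comult]
  bilinear_tensor_id_form[OF H.linear_comult] bilinear_id_tensor_form[OF H.linear_comult]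
  bilinear_tensor_id_form[OF linear_lcoact] bilinear_id_tensor_form[OF linear_lcoact]
  bilinear_tensor_id_form[OF linear_rcoact] bilinear_id_tensor_form[OF linear_rcoact]

lemma trilinear_form_parts:
  assumes "trilinear_map sE sE sE (*) \<gamma>"
  shows "trilinear_map sA sA sA (*) (\<lambda>u v w. \<gamma> (u, 0) (v, 0) (w, 0))"
    "trilinear_map sA sA sH (*) (\<lambda>u v w. \<gamma> (u, 0) (v, 0) (0, w))"
    "trilinear_map sA sH sA (*) (\<lambda>u v w. \<gamma> (u, 0) (0, v) (w, 0))"
    "trilinear_map sA sH sH (*) (\<lambda>u v w. \<gamma> (u, 0) (0, v) (0, w))"
    "trilinear_map sH sA sA (*) (\<lambda>u v w. \<gamma> (0, u) (v, 0) (w, 0))"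
    "trilinear_map sH sA sH (*) (\<lambda>u v w. \<gamma> (0, u) (v, 0) (0, w))"
    "trilinear_map sH sH sA (*) (\<lambda>u v w. \<gamma> (0, u) (0, v) (w, 0))"
    "trilinear_map sH sH sH (*) (\<lambda>u v w. \<gamma> (0, u) (0, v) (0, w))"
  by (rule trilinear_map_compose[OF assms]; rule linear_inclusions)+

text \<open>These are the forms at which the inner \<open>\<Delta>E\<close> is evaluated in
  \<open>tensor_id\<close> (last argument fixed) and \<open>id_tensor\<close> (first argument
  fixed).\<close>

lemma trilinear_slices:
  assumes "trilinear_map sE sE sE (*) \<gamma>"
  shows "bilinear_map sE sE (*) (\<lambda>p q. \<gamma> p q r)" "bilinear_map sE sE (*) (\<lambda>p q. \<gamma> r p q)"
  using assms unfolding trilinear_map_def bilinear_map_def by blast+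

lemma anti_flexible_biproduct_comult: "anti_flexible_coalgebra sE \<Delta>E"
proof
  show "linear_to_tensor sE sE sE \<Delta>E"
    by (rule linear_biproduct_comult)
  show "tensor_id sE sE sE \<Delta>E (\<Delta>E p) - id_tensor sE sE sE \<Delta>E (\<Delta>E p) =
      twist13 (tensor_id sE sE sE \<Delta>E (\<Delta>E p) - id_tensor sE sE sE \<Delta>E (\<Delta>E p))" for p
  proof
    fix \<gamma>
    show "(tensor_id sE sE sE \<Delta>E (\<Delta>E p) - id_tensor sE sE sE \<Delta>E (\<Delta>E p)) \<gamma> =
      twist13 (tensor_id sE sE sE \<Delta>E (\<Delta>E p) - id_tensor sE sE sE \<Delta>E (\<Delta>E p)) \<gamma>"
    proof (cases "trilinear_map sE sE sE (*) \<gamma>")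
      \<comment> \<open>Reversing the arguments does not affect trilinearity, so both sides evaluate
        nested tensors at the zero form and vanish.\<close>
      case False
      then show ?thesis
        by (simp add: tensor_id_eval id_tensor_eval twist13_def trilinear_map_flip13[of _ _ _ _ \<gamma>]
            tensor_space_eval_0[OF biproduct_comult_in_tensor_space])
    next
      case \<gamma>: True
      obtain a x where p: "p = (a, x)"
        by (cases p)
      \<comment> \<open>The right-hand side, being twisted, evaluates at the reversed form.\<close>
      have \<gamma>': "trilinear_map sE sE sE (*) (\<lambda>u v w. \<gamma> w v u)"
        using \<gamma> trilinear_map_flip13 by blast
      note outer = bilinear_tensor_id_form[OF linear_biproduct_comult \<gamma>]
        bilinear_id_tensor_form[OF linear_biproduct_comult \<gamma>]
        bilinear_tensor_id_form[OF linear_biproduct_comult \<gamma>']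
        bilinear_id_tensor_form[OF linear_biproduct_comult \<gamma>']
      note slices = trilinear_slices[OF \<gamma>] trilinear_slices[OF \<gamma>']
      note parts = trilinear_form_parts[OF \<gamma>] trilinear_form_parts[OF \<gamma>']
      note eval = plus_fun_apply minus_apply tensor_id_eval id_tensor_eval twist13_def
        parts[THEN eqTrueI] if_True
      \<comment> \<open>One instance for each of the eight triples of factors from A and H. The
        conditions \<open>bicomodule_coalgebra1\<close> and \<open>lcoact_comult\<close> relate two
        different triples through \<open>twist13\<close>, so each is used a second time with the
        form reversed: for AAH besides HAA, and for AHH besides HHA.\<close>
      note hyps = A.anti_coflexible[of a, THEN fun_cong, of "\<lambda>u v w. \<gamma> (u, 0) (v, 0) (w, 0)"]
        bicomodule_coalgebra1[of a, THEN fun_cong, of "\<lambda>u v w. \<gamma> (0, u) (v, 0) (w, 0)"]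
        bicomodule_coalgebra1[of a, THEN fun_cong, of "\<lambda>u v w. \<gamma> (w, 0) (v, 0) (0, u)"]
        bicomodule_coalgebra2[of a, THEN fun_cong, of "\<lambda>u v w. \<gamma> (u, 0) (0, v) (w, 0)"]
        lcoact_comult[of a, THEN fun_cong, of "\<lambda>u v w. \<gamma> (0, u) (0, v) (w, 0)"]
        lcoact_comult[of a, THEN fun_cong, of "\<lambda>u v w. \<gamma> (w, 0) (0, v) (0, u)"]
        lcoact_rcoact[of a, THEN fun_cong, of "\<lambda>u v w. \<gamma> (0, u) (v, 0) (0, w)"]
        H.anti_coflexible[of x, THEN fun_cong, of "\<lambda>u v w. \<gamma> (0, u) (0, v) (0, w)"]
      note hyps' = hyps[unfolded eval, THEN diff_eq_eq[THEN iffD1]]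
      show ?thesis
        \<comment> \<open>In order: pass to evaluations, expand outer and inner
          \<open>\<Delta>E\<close>, drop the parts of \<open>\<Delta>E\<close> at a zero component,
          split the remaining sums of forms, and substitute the conditions solved for their
          \<open>tensor_id\<close> terms.\<close>
        by (simp only: p eval \<gamma> \<gamma>',
            simp only: biproduct_comult_eval outer slices,
            simp only: structure_linear zero_fun_apply add_0_left add_0_right structure_eval_0,
            simp only: structure_eval_add bilinear_map_add structure_bilinear parts,
            simp only: hyps',
            simp add: algebra_simps)
    qed
  qed
qed

end

section \<open>Compatibility of multiplication and comultiplication\<close>

context anti_flexible_algebra_coalgebra_in_Hopf_bimodules
begin

text \<open>Collecting each compatibility condition on one side gives a tensor that can be studied
  one form at a time; the condition says that it vanishes.\<close>

definition comult_defect :: "'a \<times> 'h \<Rightarrow> 'a \<times> 'h \<Rightarrow> ('k, 'a \<times> 'h, 'a \<times> 'h) tensor" where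
  "comult_defect p q = \<Delta>E (mE p q) + twist (\<Delta>E (mE q p)) -
     (sweedler (\<Delta>E p) (\<lambda>p1 p2. tens sE sE (mE p1 q) p2)
    + sweedler (\<Delta>E p) (\<lambda>p1 p2. tens sE sE (mE q p2) p1)
    + sweedler (\<Delta>E q) (\<lambda>q1 q2. tens sE sE q1 (mE p q2))
    + sweedler (\<Delta>E q) (\<lambda>q1 q2. tens sE sE q2 (mE q1 p)))"

definition braided_comult_defect :: "'a \<Rightarrow> 'a \<Rightarrow> ('k, 'a, 'a) tensor" where
  "braided_comult_defect a b = \<Delta>A (a \<cdot> b) + twist (\<Delta>A (b \<cdot> a)) -
     (sweedler (\<Delta>A a) (\<lambda>a1 a2. tens sA sA (a1 \<cdot> b) a2)
    + sweedler (\<Delta>A a) (\<lambda>a1 a2. tens sA sA (b \<cdot> a2) a1)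
    + sweedler (\<Delta>A b) (\<lambda>b1 b2. tens sA sA b1 (a \<cdot> b2))
    + sweedler (\<Delta>A b) (\<lambda>b1 b2. tens sA sA b2 (b1 \<cdot> a))
    + sweedler (\<phi> a) (\<lambda>h a0. tens sA sA (h \<triangleright> b) a0)
    + sweedler (\<psi> a) (\<lambda>a0 h. tens sA sA (b \<triangleleft> h) a0)
    + sweedler (\<psi> b) (\<lambda>b0 h. tens sA sA b0 (a \<triangleleft> h))
    + sweedler (\<phi> b) (\<lambda>h b0. tens sA sA b0 (h \<triangleright> a)))"

definition twist_defect :: "'a \<times> 'h \<Rightarrow> 'a \<times> 'h \<Rightarrow> ('k, 'a \<times> 'h, 'a \<times> 'h) tensor" where
  "twist_defect p q = id_minus_twist
     (sweedler (\<Delta>E p) (\<lambda>p1 p2. tens sE sE p1 (mE p2 q))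
    + sweedler (\<Delta>E q) (\<lambda>q1 q2. tens sE sE (mE p q1) q2)
    - sweedler (\<Delta>E p) (\<lambda>p1 p2. tens sE sE (mE q p1) p2)
    - sweedler (\<Delta>E q) (\<lambda>q1 q2. tens sE sE q1 (mE q2 p)))"

definition braided_twist_defect :: "'a \<Rightarrow> 'a \<Rightarrow> ('k, 'a, 'a) tensor" where
  "braided_twist_defect a b =
     id_minus_twist
       (sweedler (\<Delta>A a) (\<lambda>a1 a2. tens sA sA a1 (a2 \<cdot> b))
      - sweedler (\<Delta>A a) (\<lambda>a1 a2. tens sA sA (b \<cdot> a1) a2)
      - sweedler (\<Delta>A b) (\<lambda>b1 b2. tens sA sA b1 (b2 \<cdot> a))
      + sweedler (\<Delta>A b) (\<lambda>b1 b2. tens sA sA (a \<cdot> b1) b2))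
     + id_minus_twist
       (sweedler (\<psi> a) (\<lambda>a0 h. tens sA sA a0 (h \<triangleright> b))
      - sweedler (\<phi> a) (\<lambda>h a0. tens sA sA (b \<triangleleft> h) a0)
      - sweedler (\<psi> b) (\<lambda>b0 h. tens sA sA b0 (h \<triangleright> a))
      + sweedler (\<phi> b) (\<lambda>h b0. tens sA sA (a \<triangleleft> h) b0))"

text \<open>With this, a defect vanishes as soon as it vanishes at all bilinear forms.\<close>

lemma defects_not_bilinear:
  "\<not> bilinear_map sE sE (*) \<beta> \<Longrightarrow> comult_defect p q \<beta> = 0"
  "\<not> bilinear_map sE sE (*) \<beta> \<Longrightarrow> twist_defect p q \<beta> = 0"
  "\<not> bilinear_map sA sA (*) \<beta>' \<Longrightarrow> braided_comult_defect a b \<beta>' = 0"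
  "\<not> bilinear_map sA sA (*) \<beta>' \<Longrightarrow> braided_twist_defect a b \<beta>' = 0"
  by (simp_all add: comult_defect_def twist_defect_def braided_comult_defect_def
      braided_twist_defect_def id_minus_twist_def twist_def sweedler_tens_eval structure_eval_0
      bilinear_map_flip[of _ _ _ \<beta>] bilinear_map_flip[of _ _ _ \<beta>']
      tensor_space_eval_0[OF biproduct_comult_in_tensor_space]
      tensor_space_eval_not_bilinear[OF biproduct_comult_in_tensor_space]
      tensor_space_eval_not_bilinear[OF structure_in_tensor_space(1)])

lemma bilinear_form_biproduct_mult:
  assumes "bilinear_map sE sE (*) \<beta>"
  shows "bilinear_map sE sE (*) (\<lambda>p q. \<beta> (mE p r) q)"
    "bilinear_map sE sE (*) (\<lambda>p q. \<beta> (mE r p) q)"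
    "bilinear_map sE sE (*) (\<lambda>p q. \<beta> p (mE q r))"
    "bilinear_map sE sE (*) (\<lambda>p q. \<beta> p (mE r q))"
    "bilinear_map sE sE (*) (\<lambda>p q. \<beta> (mE q r) p)"
    "bilinear_map sE sE (*) (\<lambda>p q. \<beta> (mE r q) p)"
    "bilinear_map sE sE (*) (\<lambda>p q. \<beta> q (mE p r))"
    "bilinear_map sE sE (*) (\<lambda>p q. \<beta> q (mE r p))"
    "bilinear_map sE sE (*) (\<lambda>p q. \<beta> q p)"
  using assms linear_biproduct_mult[THEN bilinear_map_precompose(1)]
    linear_biproduct_mult[THEN bilinear_map_precompose(2)]
    linear_biproduct_mult[THEN bilinear_map_precompose(3)]
    linear_biproduct_mult[THEN bilinear_map_precompose(4)] bilinear_map_flip[of sE sE "(*)" \<beta>]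
  by simp_all

text \<open>
  In the next two proofs every condition is solved for one of its terms and substituted. It is
  needed at each component of \<open>\<beta>\<close> it constrains: the conditions on an action for both pairs
  \<open>(x, b)\<close> and \<open>(y, a)\<close>, and the mixed ones also at a flipped component, since \<open>twist\<close> exchanges
  \<open>A \<otimes> H\<close> and \<open>H \<otimes> A\<close>.
\<close>

lemma comult_defect_eval:
  assumes \<beta>: "bilinear_map sE sE (*) \<beta>"
  shows "comult_defect (a, x) (b, y) \<beta> = braided_comult_defect a b (\<lambda>u v. \<beta> (u, 0) (v, 0))"
proof -
  obtain \<beta>AA \<beta>AH \<beta>HA \<beta>HH where parts:
    "bilinear_map sA sA (*) \<beta>AA" "bilinear_map sA sH (*) \<beta>AH"
    "bilinear_map sH sA (*) \<beta>HA" "bilinear_map sH sH (*) \<beta>HH"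
    and \<beta>_eq: "\<And>a x b y. \<beta> (a, x) (b, y) = \<beta>AA a b + \<beta>AH a y + \<beta>HA x b + \<beta>HH x y"
    using bilinear_form_biproduct_cases[OF \<beta>] by metis
  have flips: "bilinear_map sA sA (*) (\<lambda>u v. \<beta>AA v u)" "bilinear_map sH sA (*) (\<lambda>h v. \<beta>AH v h)"
    "bilinear_map sA sH (*) (\<lambda>v h. \<beta>HA h v)" "bilinear_map sH sH (*) (\<lambda>h k. \<beta>HH k h)"
    using parts bilinear_map_flip by blast+
  note zero = structure_linear parts[THEN bilinear_mapD(5)] parts[THEN bilinear_mapD(6)]
    add_0_left add_0_right
  note add = parts[THEN bilinear_mapD(1)] parts[THEN bilinear_mapD(2)]
  note eval = plus_fun_apply minus_apply sweedler_tens_eval twist_def if_True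
    parts[THEN eqTrueI] flips[THEN eqTrueI]
  note hyps =
    bimodule_coalgebra1[of x b, THEN fun_cong, of \<beta>AA]
    bimodule_coalgebra1[of y a, THEN fun_cong, of "\<lambda>u v. \<beta>AA v u"]
    bicomodule_algebra1[of a b, THEN fun_cong, of \<beta>HA]
    bicomodule_algebra1[of b a, THEN fun_cong, of "\<lambda>h v. \<beta>AH v h"]
    lcoact_act[of x b, THEN fun_cong, of \<beta>HA]
    lcoact_act[of y a, THEN fun_cong, of "\<lambda>h v. \<beta>AH v h"]
    rcoact_act[of x b, THEN fun_cong, of \<beta>AH]
    rcoact_act[of y a, THEN fun_cong, of "\<lambda>v h. \<beta>HA h v"]
    H.comult_mult[of x y, THEN fun_cong, of \<beta>HH]
  note hyps' = hyps[unfolded eval, THEN eq_diff_eq[THEN iffD2]]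
  show ?thesis
    \<comment> \<open>\<open>\<Delta>E\<close> is expanded while the forms on E are still visibly
      bilinear; only then is \<open>\<beta>\<close> replaced by its components. This also turns the
      form on the right-hand side into \<open>\<beta>AA\<close>, so that the braided defect can be
      evaluated.\<close>
    by (simp only: comult_defect_def braided_comult_defect_def eval \<beta> biproduct_mult_Pair,
        simp only: biproduct_comult_eval bilinear_form_biproduct_mult \<beta>,
        simp only: biproduct_mult_Pair \<beta>_eq,
        simp only: zero add parts eval,
        simp only: structure_eval_add bilinear_map_add bilinear_form_mult parts flips,
        simp only: hyps',
        simp add: algebra_simps)
qed

lemma twist_defect_eval:
  assumes \<beta>: "bilinear_map sE sE (*) \<beta>"
  shows "twist_defect (a, x) (b, y) \<beta> = braided_twist_defect a b (\<lambda>u v. \<beta> (u, 0) (v, 0))"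
proof -
  obtain \<beta>AA \<beta>AH \<beta>HA \<beta>HH where parts:
    "bilinear_map sA sA (*) \<beta>AA" "bilinear_map sA sH (*) \<beta>AH"
    "bilinear_map sH sA (*) \<beta>HA" "bilinear_map sH sH (*) \<beta>HH"
    and \<beta>_eq: "\<And>a x b y. \<beta> (a, x) (b, y) = \<beta>AA a b + \<beta>AH a y + \<beta>HA x b + \<beta>HH x y"
    using bilinear_form_biproduct_cases[OF \<beta>] by metis
  have flips: "bilinear_map sA sA (*) (\<lambda>u v. \<beta>AA v u)" "bilinear_map sH sA (*) (\<lambda>h v. \<beta>AH v h)"
    "bilinear_map sA sH (*) (\<lambda>v h. \<beta>HA h v)" "bilinear_map sH sH (*) (\<lambda>h k. \<beta>HH k h)"
    using parts bilinear_map_flip by blast+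
  note zero = structure_linear parts[THEN bilinear_mapD(5)] parts[THEN bilinear_mapD(6)]
    add_0_left add_0_right
  note add = parts[THEN bilinear_mapD(1)] parts[THEN bilinear_mapD(2)]
  note eval = plus_fun_apply minus_apply sweedler_tens_eval twist_def if_True id_minus_twist_def
    zero_fun_apply parts[THEN eqTrueI] flips[THEN eqTrueI]
  note hyps1 =
    bimodule_coalgebra2[of b x, THEN fun_cong, of \<beta>AA]
    bimodule_coalgebra2[of a y, THEN fun_cong, of \<beta>AA]
  note hyps2 =
    bicomodule_algebra2[of a b, THEN fun_cong, of \<beta>HA]
    bicomodule_algebra2[of a b, THEN fun_cong, of "\<lambda>h v. \<beta>AH v h"]
  note hyps3 =
    coact_act_twist[of b x, THEN fun_cong, of \<beta>AH]
    coact_act_twist[of b x, THEN fun_cong, of "\<lambda>v h. \<beta>HA h v"]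
    coact_act_twist[of a y, THEN fun_cong, of \<beta>AH]
    coact_act_twist[of a y, THEN fun_cong, of "\<lambda>v h. \<beta>HA h v"]
  note hyps4 = H.comult_mult_twist[of x y, THEN fun_cong, of \<beta>HH]
  note diff = diff_eq_eq[THEN iffD1]
  \<comment> \<open>The groups differ in how many subtractions must be moved before a single term is
    left. In the first and last group the vanishing of id minus \<open>twist\<close> is first read
    as equality of a tensor with its twist.\<close>
  note hyps' = hyps1[unfolded eval, THEN right_minus_eq[THEN iffD1], THEN diff]
    hyps2[unfolded eval, THEN diff] hyps3[unfolded eval, THEN diff, THEN diff]
    hyps4[unfolded eval, THEN right_minus_eq[THEN iffD1], THEN diff, THEN diff,
      THEN eq_diff_eq[THEN iffD2]]
  show ?thesis
    by (simp only: twist_defect_def braided_twist_defect_def eval \<beta> biproduct_mult_Pair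
          bilinear_form_biproduct_mult(9),
        simp only: biproduct_comult_eval bilinear_form_biproduct_mult \<beta>,
        simp only: biproduct_mult_Pair \<beta>_eq,
        simp only: zero add parts flips eval,
        simp only: structure_eval_add bilinear_map_add bilinear_form_mult parts flips,
        simp only: hyps',
        simp add: algebra_simps)
qed

text \<open>A defect on E at a form is the braided defect at its restriction to A. This settles one
  direction; the other needs every bilinear form on A to arise as such a restriction.\<close>

lemma comult_defect_eq_0_iff:
  "(\<forall>p q. comult_defect p q = 0) \<longleftrightarrow> (\<forall>a b. braided_comult_defect a b = 0)" (is ?thesis1)
  and twist_defect_eq_0_iff:
  "(\<forall>p q. twist_defect p q = 0) \<longleftrightarrow> (\<forall>a b. braided_twist_defect a b = 0)" (is ?thesis2)
proof -
  \<comment> \<open>Pulling back along the projection to A extends a form from A to E, and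
    restricting the result to A returns the original form.\<close>
  have fst_form: "bilinear_map sE sE (*) (\<lambda>p q. \<beta> (fst p) (fst q))"
    if "bilinear_map sA sA (*) \<beta>" for \<beta>
    by (rule bilinear_map_compose[OF that E.linear_fst E.linear_fst])
  show ?thesis1
  proof (intro iffI allI ext)
    fix a b \<beta> assume "\<forall>p q. comult_defect p q = 0"
    then show "braided_comult_defect a b \<beta> = 0 \<beta>"
      using comult_defect_eval[OF fst_form, of \<beta> a 0 b 0] defects_not_bilinear(3)
      by (cases "bilinear_map sA sA (*) \<beta>") simp_all
  next
    fix p q \<beta> assume "\<forall>a b. braided_comult_defect a b = 0"
    then show "comult_defect p q \<beta> = 0 \<beta>"
      using comult_defect_eval[of \<beta> "fst p" "snd p" "fst q" "snd q"] defects_not_bilinear(1)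
      by (cases "bilinear_map sE sE (*) \<beta>") simp_all
  qed
  show ?thesis2
  proof (intro iffI allI ext)
    fix a b \<beta> assume "\<forall>p q. twist_defect p q = 0"
    then show "braided_twist_defect a b \<beta> = 0 \<beta>"
      using twist_defect_eval[OF fst_form, of \<beta> a 0 b 0] defects_not_bilinear(4)
      by (cases "bilinear_map sA sA (*) \<beta>") simp_all
  next
    fix p q \<beta> assume "\<forall>a b. braided_twist_defect a b = 0"
    then show "twist_defect p q \<beta> = 0 \<beta>"
      using twist_defect_eval[of \<beta> "fst p" "snd p" "fst q" "snd q"] defects_not_bilinear(2)
      by (cases "bilinear_map sE sE (*) \<beta>") simp_all
  qed
qed

end

theorem theorem3p3:
  fixes sH :: "'k::field_char_0 \<Rightarrow> 'h::ab_group_add \<Rightarrow> 'h"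
    and mH :: "'h \<Rightarrow> 'h \<Rightarrow> 'h"
    and \<Delta>H :: "'h \<Rightarrow> ('k, 'h, 'h) tensor"
    and sA :: "'k \<Rightarrow> 'a::ab_group_add \<Rightarrow> 'a"
    and mA :: "'a \<Rightarrow> 'a \<Rightarrow> 'a"
    and \<Delta>A :: "'a \<Rightarrow> ('k, 'a, 'a) tensor"
    and lact :: "'h \<Rightarrow> 'a \<Rightarrow> 'a"
    and ract :: "'a \<Rightarrow> 'h \<Rightarrow> 'a"
    and \<phi> :: "'a \<Rightarrow> ('k, 'h, 'a) tensor"
    and \<psi> :: "'a \<Rightarrow> ('k, 'a, 'h) tensor"
  assumes "anti_flexible_bialgebra sH mH \<Delta>H"
    and "anti_flexible_algebra_coalgebra_in_Hopf_bimodules sH mH \<Delta>H sA mA \<Delta>A lact ract \<phi> \<psi>"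
  shows "anti_flexible_bialgebra (module_prod.scale sA sH)
           (biproduct_mult mH mA lact ract) (biproduct_comult sH \<Delta>H sA \<Delta>A \<phi> \<psi>)
         \<longleftrightarrow> braided_anti_flexible_bialgebra sH mH \<Delta>H sA mA \<Delta>A lact ract \<phi> \<psi>"
proof -
  interpret anti_flexible_algebra_coalgebra_in_Hopf_bimodules sH mH \<Delta>H sA mA \<Delta>A lact ract \<phi> \<psi>
    by fact
  \<comment> \<open>The biproduct is always an anti-flexible algebra and coalgebra, so being a
    bialgebra comes down to the two compatibility conditions.\<close>
  have "anti_flexible_bialgebra sE mE \<Delta>E \<longleftrightarrow>
      (\<forall>p q. comult_defect p q = 0) \<and> (\<forall>p q. twist_defect p q = 0)"
    by (simp only: anti_flexible_bialgebra_def anti_flexible_algebra_coalgebra_def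
        anti_flexible_bialgebra_axioms_def anti_flexible_biproduct_mult
        anti_flexible_biproduct_comult comult_defect_def twist_defect_def right_minus_eq simp_thms)
  also have "\<dots> \<longleftrightarrow> (\<forall>a b. braided_comult_defect a b = 0) \<and> (\<forall>a b. braided_twist_defect a b = 0)"
    by (simp only: comult_defect_eq_0_iff twist_defect_eq_0_iff)
  also have "\<dots> \<longleftrightarrow> braided_anti_flexible_bialgebra sH mH \<Delta>H sA mA \<Delta>A lact ract \<phi> \<psi>"
    by (simp only: braided_anti_flexible_bialgebra_def braided_anti_flexible_bialgebra_axioms_def
        assms braided_comult_defect_def braided_twist_defect_def right_minus_eq simp_thms)
  finally show ?thesis .
qed

end
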